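(* Let $p$ be a prime with $p\equiv 11$ or $19 \pmod{20}$. Then for all integers $n,k\geq 0$ with $p\nmid n$, \[ c_{9,1}\left(8p^{2k+1}n+\frac{6p^{2k+2}+4}{5}\right)\equiv 0 \pmod 2 \quad\text{and}\quad c_{9,1}\left(8p^{2k+1}n+\frac{26p^{2k+2}+4}{5}\right)\equiv 0 \pmod 2. \]
   Context: For complex $a,b$ the false theta function is $\Psi(a,b):=\sum_{n=0}^\infty a^{n(n+1)/2}b^{n(n-1)/2}-\sum_{n=-\infty}^{-1}a^{n(n+1)/2}b^{n(n-1)/2}$. For positive integers $r,s$, the integers $c_{r,s}(n)$ ($n\ge 0$) are defined by the power series identity $\sum_{n=0}^\infty c_{r,s}(n)q^n=\dfrac{1}{\Psi(-q^r,q^s)}$ (the denominator is a power series in $q$ with constant term $1$). *)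

theory Defs
  imports "HOL-Analysis.Analysis" "HOL-Number_Theory.Number_Theory"
begin

text \<open>
  The false theta function \<open>\<Psi>(a, b)\<close>. The definition is polymorphic: at type \<^typ>\<open>complex\<close> it is the
  analytic function, and at type \<^typ>\<open>int fps\<close>, whose metric is the \<open>X\<close>-adic one, it is the formal
  version that is needed for the substitution \<open>a = -q\<^sup>r\<close>, \<open>b = q\<^sup>s\<close>.
  For integral \<open>n\<close> both \<open>n(n+1)/2\<close> and \<open>n(n-1)/2\<close> are nonnegative integers, so neither
  \<open>div\<close> nor \<open>nat\<close> loses information.
\<close>

definition false_theta_term :: "'a::comm_ring_1 \<Rightarrow> 'a \<Rightarrow> int \<Rightarrow> 'a" where
  "false_theta_term a b n = a ^ nat (n * (n + 1) div 2) * b ^ nat (n * (n - 1) div 2)"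

definition false_theta :: "'a::{comm_ring_1, t2_space} \<Rightarrow> 'a \<Rightarrow> 'a" where
  "false_theta a b =
     (\<Sum>\<^sub>\<infinity>n\<in>{0..}. false_theta_term a b n) - (\<Sum>\<^sub>\<infinity>n\<in>{..-1}. false_theta_term a b n)"

definition false_theta_q :: "nat \<Rightarrow> nat \<Rightarrow> int fps" where
  "false_theta_q r s = false_theta (- (fps_X ^ r)) (fps_X ^ s)"

text \<open>
  The generating function of \<open>c\<^bsub>r,s\<^esub>\<close> is the multiplicative inverse of \<open>\<Psi>(-q\<^sup>r, q\<^sup>s)\<close> in the ring of
  integral power series; it exists and is unique for positive \<open>r\<close> and \<open>s\<close>
  (see \<open>c_coeff_generating_function\<close> and \<open>c_coeff_unique\<close>).
\<close>

definition c_coeff :: "nat \<Rightarrow> nat \<Rightarrow> nat \<Rightarrow> int" where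
  "c_coeff r s n = fps_nth (THE C. C * false_theta_q r s = 1) n"

lemma has_sum_fps:
  fixes f :: "'i \<Rightarrow> 'a::ab_group_add fps"
  assumes "\<And>n. finite {i\<in>A. fps_nth (f i) n \<noteq> 0}"
  shows "(f has_sum Abs_fps (\<lambda>n. \<Sum>i | i \<in> A \<and> fps_nth (f i) n \<noteq> 0. fps_nth (f i) n)) A"
  unfolding has_sum_def
proof (rule tendsto_fpsI)
  fix n
  let ?B = "{i\<in>A. fps_nth (f i) n \<noteq> 0}"
  show "\<forall>\<^sub>F X in finite_subsets_at_top A. fps_nth (sum f X) n =
      fps_nth (Abs_fps (\<lambda>n. \<Sum>i | i \<in> A \<and> fps_nth (f i) n \<noteq> 0. fps_nth (f i) n)) n"
    unfolding eventually_finite_subsets_at_top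
  proof (intro exI[of _ ?B] conjI allI impI)
    fix X assume X: "finite X \<and> ?B \<subseteq> X \<and> X \<subseteq> A"
    have "fps_nth (sum f X) n = (\<Sum>i\<in>X. fps_nth (f i) n)" by (simp add: fps_sum_nth)
    also have "\<dots> = (\<Sum>i\<in>?B. fps_nth (f i) n)"
      using X by (intro sum.mono_neutral_right) auto
    finally show "fps_nth (sum f X) n =
      fps_nth (Abs_fps (\<lambda>n. \<Sum>i | i \<in> A \<and> fps_nth (f i) n \<noteq> 0. fps_nth (f i) n)) n" by simp
  qed (use assms in auto)
qed

definition false_theta_exp :: "nat \<Rightarrow> nat \<Rightarrow> int \<Rightarrow> nat" where
  "false_theta_exp r s n = r * nat (n * (n + 1) div 2) + s * nat (n * (n - 1) div 2)"

lemma nth_false_theta_term: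
  "fps_nth (false_theta_term (- (fps_X ^ r)) (fps_X ^ s) n :: int fps) m =
     (if m = false_theta_exp r s n then (-1) ^ nat (n * (n + 1) div 2) else 0)"
proof -
  define i where "i = nat (n * (n + 1) div 2)"
  define j where "j = nat (n * (n - 1) div 2)"
  have "(- (fps_X ^ r) :: int fps) ^ i = fps_const ((-1) ^ i) * fps_X ^ (r * i)"
    by (subst power_minus) (simp only: power_mult fps_const_power [symmetric] flip: fps_const_neg fps_const_1_eq_1)
  hence *: "(- (fps_X ^ r) :: int fps) ^ i * (fps_X ^ s) ^ j =
      fps_const ((-1) ^ i) * fps_X ^ (r * i + s * j)"
    by (simp only: power_mult power_add mult.assoc)
  thus ?thesis
    unfolding false_theta_term_def false_theta_exp_def i_def [symmetric] j_def [symmetric] *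
    by (simp only: fps_mult_left_const_nth fps_X_power_nth) simp
qed

lemma false_theta_exp_ge:
  assumes "r > 0" "s > 0"
  shows "\<bar>n\<bar> \<le> int (false_theta_exp r s n)"
proof -
  define i where "i = n * (n + 1) div 2"
  define j where "j = n * (n - 1) div 2"
  have i: "2 * i = n * (n + 1)" unfolding i_def by (simp add: algebra_simps)
  have j: "2 * j = n * (n - 1)" unfolding j_def by (simp add: algebra_simps)
  have "n * (n + 1) \<ge> 0" "n * (n - 1) \<ge> 0"
    by (auto simp: zero_le_mult_iff)
  hence ij0: "i \<ge> 0" "j \<ge> 0" using i j by auto
  have "2 * (i + j) = 2 * (n * n)" using i j by (simp add: algebra_simps)
  hence "i + j = n * n" by simp
  moreover have "\<bar>n\<bar> * 1 \<le> \<bar>n\<bar> * \<bar>n\<bar>"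
    by (cases "n = 0") (simp, intro mult_left_mono, auto)
  ultimately have "\<bar>n\<bar> \<le> i + j" by simp
  also have "\<dots> = int (1 * nat i + 1 * nat j)" using ij0 by simp
  also have "\<dots> \<le> int (false_theta_exp r s n)"
    unfolding false_theta_exp_def i_def [symmetric] j_def [symmetric] of_nat_le_iff
    using assms by (intro add_mono mult_right_mono) auto
  finally show ?thesis .
qed

lemma finite_false_theta_exp:
  assumes "r > 0" "s > 0"
  shows "finite {n. false_theta_exp r s n = m}"
proof (rule finite_subset)
  show "{n. false_theta_exp r s n = m} \<subseteq> {- int m..int m}"
  proof
    fix n assume "n \<in> {n. false_theta_exp r s n = m}"
    thus "n \<in> {- int m..int m}"
      using false_theta_exp_ge[OF assms, of n] by auto
  qed
qed auto

lemma infsum_false_theta_term: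
  assumes "r > 0" "s > 0"
  shows "false_theta_term (- (fps_X ^ r)) (fps_X ^ s :: int fps) summable_on A"
    and "fps_nth (\<Sum>\<^sub>\<infinity>n\<in>A. false_theta_term (- (fps_X ^ r)) (fps_X ^ s :: int fps) n) m =
       (\<Sum>n | n \<in> A \<and> false_theta_exp r s n = m. (-1) ^ nat (n * (n + 1) div 2))"
proof -
  let ?f = "false_theta_term (- (fps_X ^ r)) (fps_X ^ s :: int fps)"
  have eq: "{n\<in>A. fps_nth (?f n) m \<noteq> 0} = {n \<in> A. false_theta_exp r s n = m}" for m
    by (auto simp: nth_false_theta_term)
  have *: "(?f has_sum Abs_fps (\<lambda>m. \<Sum>n | n \<in> A \<and> fps_nth (?f n) m \<noteq> 0. fps_nth (?f n) m)) A"
    using finite_false_theta_exp[OF assms] by (intro has_sum_fps) (simp add: eq)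
  show "?f summable_on A" using * by (auto simp: summable_on_def)
  show "fps_nth (\<Sum>\<^sub>\<infinity>n\<in>A. ?f n) m =
       (\<Sum>n | n \<in> A \<and> false_theta_exp r s n = m. (-1) ^ nat (n * (n + 1) div 2))"
    by (simp add: infsumI[OF *] eq) (auto intro!: sum.cong simp: nth_false_theta_term)
qed

lemma false_theta_q_nth:
  assumes "r > 0" "s > 0"
  shows "fps_nth (false_theta_q r s) m =
     (\<Sum>n | n \<ge> 0 \<and> false_theta_exp r s n = m. (-1) ^ nat (n * (n + 1) div 2)) -
     (\<Sum>n | n \<le> -1 \<and> false_theta_exp r s n = m. (-1) ^ nat (n * (n + 1) div 2))"
  unfolding false_theta_q_def false_theta_def
  using assms by (simp add: infsum_false_theta_term)

lemma false_theta_q_nth_0: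
  assumes "r > 0" "s > 0"
  shows "fps_nth (false_theta_q r s) 0 = 1"
proof -
  have *: "false_theta_exp r s n = 0 \<longleftrightarrow> n = 0" for n
  proof
    assume "false_theta_exp r s n = 0"
    thus "n = 0" using false_theta_exp_ge[OF assms, of n] by simp
  qed (simp add: false_theta_exp_def)
  have "{n. n \<ge> 0 \<and> false_theta_exp r s n = 0} = {0}"
       "{n. n \<le> -1 \<and> false_theta_exp r s n = 0} = {}"
    using * by auto
  thus ?thesis using assms by (simp only: false_theta_q_nth) simp
qed

lemma c_coeff_generating_function:
  assumes "r > 0" "s > 0"
  shows "Abs_fps (c_coeff r s) * false_theta_q r s = 1"
proof -
  let ?P = "false_theta_q r s"
  have inv: "fps_right_inverse ?P 1 * ?P = 1"
    using fps_right_inverse[of ?P 1] false_theta_q_nth_0[OF assms] by (simp add: mult.commute)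
  have "\<exists>!C. C * ?P = 1"
  proof (rule ex1I[of _ "fps_right_inverse ?P 1"])
    show "fps_right_inverse ?P 1 * ?P = 1" by (fact inv)
  next
    fix C assume "C * ?P = 1"
    hence "C * ?P = fps_right_inverse ?P 1 * ?P" using inv by simp
    moreover have "?P \<noteq> 0" using inv by auto
    ultimately show "C = fps_right_inverse ?P 1" by simp
  qed
  from theI'[OF this] show ?thesis
    by (simp add: c_coeff_def [abs_def] fps_nth_inverse)
qed

lemma c_coeff_unique:
  assumes "r > 0" "s > 0" "C * false_theta_q r s = 1"
  shows "C = Abs_fps (c_coeff r s)"
proof -
  have "C * false_theta_q r s = Abs_fps (c_coeff r s) * false_theta_q r s"
    using c_coeff_generating_function[OF assms(1,2)] assms(3) by simp
  moreover have "false_theta_q r s \<noteq> 0" using assms(3) by auto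
  ultimately show ?thesis by simp
qed

text \<open>The divisions by \<open>5\<close> in the theorem are exact.\<close>

lemma argument_dvd:
  fixes p k :: nat
  assumes "[p = 11] (mod 20) \<or> [p = 19] (mod 20)"
  shows "5 dvd 6 * p ^ (2 * k + 2) + 4" and "5 dvd 26 * p ^ (2 * k + 2) + 4"
proof -
  have "p mod 5 = 1 \<or> p mod 5 = 4"
    using assms mod_mod_cancel[of 5 20 p] by (auto simp: cong_def)
  hence "[p ^ 2 = 1] (mod 5)"
    using power_mod[of p 5 2] by (auto simp: cong_def)
  hence "[(p ^ 2) ^ (k + 1) = 1 ^ (k + 1)] (mod 5)"
    by (rule cong_pow)
  moreover have "(p ^ 2) ^ (k + 1) = p ^ (2 * k + 2)"
    by (simp only: power_mult [symmetric] distrib_left mult_1_right)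
  ultimately have "p ^ (2 * k + 2) mod 5 = 1"
    by (simp add: cong_def)
  thus "5 dvd 6 * p ^ (2 * k + 2) + 4" "5 dvd 26 * p ^ (2 * k + 2) + 4"
    by presburger+
qed

end

theory Submission
  imports Defs "HOL-Library.Z2"
begin

text \<open>
  Write \<open>\<theta>(u, v) = \<Sum>\<^sub>n q^((u n\<^sup>2 + v n) / 2)\<close>, over the field with two elements, and let
  \<open>A = \<theta>(10, 8)\<close>, \<open>a = \<theta>(5, 3)\<close>, \<open>b = \<theta>(5, 1)\<close>, \<open>\<psi> = \<theta>(4, 2)\<close>, \<open>P = \<theta>(20, 10)\<close>, so that \<open>P\<close> is
  \<open>\<psi>\<close> at \<open>q\<^sup>5\<close>. Modulo 2 the generating function of \<open>c\<^bsub>9,1\<^esub>\<close> is \<open>C = 1 / A\<close>. Squaring is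
  \<open>q \<mapsto> q\<^sup>2\<close>, so \<open>C = C^4 A^3\<close> together with \<open>A = B^4 + q D^4\<close> for \<open>B = \<theta>(10, 4)\<close>, \<open>D = \<theta>(10, 6)\<close> shows
  that \<open>c\<^bsub>9,1\<^esub>(4n + 2)\<close> is the \<open>n\<close>-th coefficient of \<open>C B D\<^sup>2\<close>. The identities \<open>A b\<^sup>2 = P a\<close>,
  \<open>B D = P b\<close>, \<open>D = a\<^sup>2\<close> and \<open>a b = \<psi>\<^sup>2 + q P\<^sup>2\<close> turn this series into \<open>(b \<psi>)\<^sup>2 + q (b P)\<^sup>2\<close>.
  Hence \<open>c\<^bsub>9,1\<^esub>(8n + 2)\<close> and \<open>c\<^bsub>9,1\<^esub>(8n + 6)\<close> count, modulo 2, representations of \<open>40n + 6\<close> by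
  \<open>x\<^sup>2 + 5y\<^sup>2\<close> and of \<open>40n + 26\<close> by \<open>x\<^sup>2 + 25y\<^sup>2\<close>. As \<open>p \<equiv> 3 (mod 4)\<close> and \<open>5\<close> is a square modulo
  \<open>p\<close>, neither form represents a number of odd \<open>p\<close>-adic valuation.
\<close>

section \<open>Theta series modulo 2\<close>

definition count_fps :: "'i set \<Rightarrow> ('i \<Rightarrow> nat) \<Rightarrow> 'a::semiring_1 fps" where
  "count_fps I e = Abs_fps (\<lambda>n. of_nat (card {i\<in>I. e i = n}))"

text \<open>Theta identities are reduced by this to bijections of index sets that preserve
  exponents.\<close>

lemma count_fps_reindex:
  assumes "bij_betw h I J" and "\<And>i. i \<in> I \<Longrightarrow> f (h i) = e i"
  shows "count_fps I e = count_fps J f"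
proof -
  have "bij_betw h {i\<in>I. e i = n} {j\<in>J. f j = n}" for n
    using assms unfolding bij_betw_def inj_on_def by (auto simp: image_iff)
  then have "card {i\<in>I. e i = n} = card {j\<in>J. f j = n}" for n
    by (rule bij_betw_same_card)
  then show ?thesis
    by (simp add: count_fps_def)
qed

lemma count_fps_Un:
  assumes "I \<inter> J = {}" and "\<And>n. finite {i\<in>I. e i = n}" and "\<And>n. finite {i\<in>J. e i = n}"
  shows "count_fps (I \<union> J) e = count_fps I e + count_fps J e"
proof -
  have "{i \<in> I \<union> J. e i = n} = {i\<in>I. e i = n} \<union> {i\<in>J. e i = n}" for n
    by auto
  moreover have "card ({i\<in>I. e i = n} \<union> {i\<in>J. e i = n}) = card {i\<in>I. e i = n} + card {i\<in>J. e i = n}" for n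
    using assms by (intro card_Un_disjoint) auto
  ultimately show ?thesis
    by (simp add: count_fps_def fps_eq_iff)
qed

lemma count_fps_shift:
  "count_fps I (\<lambda>i. e i + k) = fps_X ^ k * (count_fps I e :: 'a::comm_ring_1 fps)"
proof (rule fps_ext)
  fix n
  have "{i\<in>I. e i + k = n} = (if n < k then {} else {i\<in>I. e i = n - k})"
    by auto
  then show "fps_nth (count_fps I (\<lambda>i. e i + k)) n = fps_nth (fps_X ^ k * (count_fps I e :: 'a fps)) n"
    by (simp add: count_fps_def fps_X_power_mult_nth)
qed

lemma count_fps_mult:
  fixes I :: "'i set" and J :: "'j set"
  assumes "\<And>n. finite {i\<in>I. e i = n}" and "\<And>n. finite {j\<in>J. f j = n}"
  shows "count_fps I e * count_fps J f
      = (count_fps (I \<times> J) (\<lambda>(i, j). e i + f j) :: 'a::semiring_1 fps)"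
proof (rule fps_ext)
  fix n
  let ?A = "\<lambda>k. {i\<in>I. e i = k} \<times> {j\<in>J. f j = n - k}"
  have "{x \<in> I \<times> J. (case x of (i, j) \<Rightarrow> e i + f j) = n} = (\<Union>k\<in>{0..n}. ?A k)"
    by auto
  moreover have "card (\<Union>k\<in>{0..n}. ?A k) = (\<Sum>k=0..n. card (?A k))"
    using assms by (intro card_UN_disjoint) auto
  ultimately show "fps_nth (count_fps I e * count_fps J f) n
      = fps_nth (count_fps (I \<times> J) (\<lambda>(i, j). e i + f j) :: 'a fps) n"
    by (simp add: count_fps_def fps_mult_nth card_cartesian_product)
qed

section \<open>Squaring over the field with two elements\<close>

lemma bit_fps_add_self: "F + F = 0" for F :: "bit fps"
  by (simp add: fps_eq_iff)

text \<open>Swapping \<open>i\<close> and \<open>n - i\<close> cancels the off-diagonal terms in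
  pairs, and squaring fixes every element of \<open>bit\<close>.\<close>

lemma bit_fps_square_nth:
  fixes F :: "bit fps"
  shows "fps_nth (F\<^sup>2) n = (if even n then fps_nth F (n div 2) else 0)"
proof -
  let ?g = "\<lambda>i. fps_nth F i * fps_nth F (n - i)"
  let ?L = "{i. 2 * i < n}" and ?R = "{i. i \<le> n \<and> n < 2 * i}" and ?M = "{i. 2 * i = n}"
  have fin: "finite ?L" "finite ?R" "finite ?M"
    by (auto intro: finite_subset[of _ "{..n}"])
  have "sum ?g ?L = sum ?g ?R"
    by (rule sum.reindex_bij_witness[of _ "\<lambda>i. n - i" "\<lambda>i. n - i"]) (auto simp: mult.commute)
  then have LR: "sum ?g ?L + sum ?g ?R = 0"
    by (cases "sum ?g ?R") simp_all
  have "{0..n} = (?L \<union> ?R) \<union> ?M"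
    by auto
  then have "fps_nth (F\<^sup>2) n = sum ?g ((?L \<union> ?R) \<union> ?M)"
    by (simp add: power2_eq_square fps_mult_nth)
  also have "\<dots> = sum ?g (?L \<union> ?R) + sum ?g ?M"
    using fin by (intro sum.union_disjoint) auto
  also have "sum ?g (?L \<union> ?R) = sum ?g ?L + sum ?g ?R"
    using fin by (intro sum.union_disjoint) auto
  also have "\<dots> = 0"
    by (rule LR)
  also have "sum ?g ?M = (if even n then fps_nth F (n div 2) else 0)"
  proof (cases "even n")
    case True
    then have "?M = {n div 2}" by auto
    moreover have "n - n div 2 = n div 2" using True by auto
    ultimately show ?thesis using True by simp
  next
    case False
    then have "?M = {}" by auto
    then show ?thesis using False by simp
  qed
  finally show ?thesis by simp
qed

lemma bit_fps_fourth_power_nth: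
  fixes F :: "bit fps"
  shows "fps_nth (F ^ 4) n = (if 4 dvd n then fps_nth F (n div 4) else 0)"
proof -
  have "F ^ 4 = (F\<^sup>2)\<^sup>2"
    by simp
  moreover have "even n \<and> even (n div 2) \<longleftrightarrow> 4 dvd n" "n div 2 div 2 = n div 4"
    by presburger+
  ultimately show ?thesis
    unfolding \<open>F ^ 4 = (F\<^sup>2)\<^sup>2\<close> by (simp only: bit_fps_square_nth) auto
qed

lemma bit_fps_square_count_fps:
  "(count_fps I e :: bit fps)\<^sup>2 = count_fps I (\<lambda>i. 2 * e i)"
proof (rule fps_ext)
  fix n
  have "{i\<in>I. 2 * e i = n} = (if even n then {i\<in>I. e i = n div 2} else {})"
    by auto
  then show "fps_nth ((count_fps I e :: bit fps)\<^sup>2) n = fps_nth (count_fps I (\<lambda>i. 2 * e i)) n"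
    by (simp add: bit_fps_square_nth) (simp add: count_fps_def)
qed

section \<open>Theta series, their products and dissections\<close>

definition theta_exp :: "int \<Rightarrow> int \<Rightarrow> int \<Rightarrow> nat" where
  "theta_exp u v n = nat ((u * n\<^sup>2 + v * n) div 2)"

definition theta :: "int \<Rightarrow> int \<Rightarrow> bit fps" where
  "theta u v = count_fps UNIV (theta_exp u v)"

text \<open>For nonzero \<open>n\<close> the integer
  \<open>u * \<bar>n\<bar> - \<bar>v\<bar>\<close> is at least 1. The bound gives both nonnegative
  exponents and finitely many indices for each exponent.\<close>

lemma theta_exp_lower_bound:
  fixes u v n :: int
  assumes "\<bar>v\<bar> < u"
  shows "\<bar>n\<bar> \<le> u * n\<^sup>2 + v * n"
proof (cases "n = 0")
  case False
  then have "u * 1 \<le> u * \<bar>n\<bar>"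
    using assms by (intro mult_left_mono) auto
  then have "1 \<le> u * \<bar>n\<bar> - \<bar>v\<bar>"
    using assms by linarith
  then have "\<bar>n\<bar> * 1 \<le> \<bar>n\<bar> * (u * \<bar>n\<bar> - \<bar>v\<bar>)"
    by (intro mult_left_mono) auto
  also have "\<dots> = u * n\<^sup>2 - \<bar>v * n\<bar>"
    by (simp add: algebra_simps abs_mult power2_eq_square)
  also have "\<dots> \<le> u * n\<^sup>2 + v * n"
    by linarith
  finally show ?thesis by simp
qed simp

text \<open>Halving and \<open>nat\<close> lose nothing here, so identities between exponents can be
  checked, doubled, as polynomial identities over the integers.\<close>

lemma two_theta_exp:
  assumes "\<bar>v\<bar> < u" "even (u + v)"
  shows "2 * int (theta_exp u v n) = u * n\<^sup>2 + v * n"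
proof -
  have "even (u * n\<^sup>2 + v * n)"
    using assms by auto
  moreover have "u * n\<^sup>2 + v * n \<ge> 0"
    using theta_exp_lower_bound[OF assms(1), of n] by linarith
  ultimately show ?thesis
    by (simp add: theta_exp_def)
qed

lemma finite_theta_exp:
  assumes "\<bar>v\<bar> < u" "even (u + v)"
  shows "finite {n\<in>I. theta_exp u v n = m}"
proof (rule finite_subset)
  show "{n\<in>I. theta_exp u v n = m} \<subseteq> {- int (2 * m)..int (2 * m)}"
    using theta_exp_lower_bound[OF assms(1)] two_theta_exp[OF assms] by auto (smt (verit))+
qed simp

lemma theta_square:
  assumes "\<bar>v\<bar> < u" "even (u + v)"
  shows "(theta u v)\<^sup>2 = theta (2 * u) (2 * v)"
proof -
  have "2 * theta_exp u v n = theta_exp (2 * u) (2 * v) n" for n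
  proof -
    have "2 * int (2 * theta_exp u v n) = 2 * int (theta_exp (2 * u) (2 * v) n)"
      using two_theta_exp[OF assms, of n] two_theta_exp[of "2 * v" "2 * u" n] assms
      by (simp add: algebra_simps)
    then show ?thesis by linarith
  qed
  then show ?thesis
    by (simp add: theta_def bit_fps_square_count_fps)
qed

lemma theta_mult:
  assumes "\<bar>v\<bar> < u" "even (u + v)" "\<bar>w\<bar> < t" "even (t + w)"
  shows "theta u v * theta t w = count_fps UNIV (\<lambda>(x, y). theta_exp u v x + theta_exp t w y)"
  using finite_theta_exp[OF assms(1,2), of UNIV] finite_theta_exp[OF assms(3,4), of UNIV]
  by (simp add: theta_def count_fps_mult)

text \<open>Substitute \<open>u = x + y\<close>, \<open>n = x - y\<close> in the exponents. They are invariant under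
  \<open>u \<mapsto> -1 - u\<close>, so whichever of \<open>u\<close> and \<open>-1 - u\<close> is even can be written as \<open>2 k\<close>.\<close>

lemma theta_mult_rearrange:
  assumes "\<bar>b\<bar> < 2 * w" "\<bar>2 * w - b\<bar> < 2 * w" "even b"
  shows "theta (2 * w) b * theta (2 * w) (2 * w - b) = theta (4 * w) (2 * w) * theta w (b - w)"
proof -
  define h :: "int \<times> int \<Rightarrow> int \<times> int" where
    "h = (\<lambda>(k, n). let u = (if even n then 2 * k else - 2 * k - 1) in ((u + n) div 2, (u - n) div 2))"
  define g :: "int \<times> int \<Rightarrow> int \<times> int" where
    "g = (\<lambda>(x, y). (if even (x + y) then (x + y) div 2 else - (x + y + 1) div 2, x - y))"
  have bij: "bij_betw h UNIV UNIV"
  proof (rule bij_betw_byWitness[of _ g]; safe?)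
    show "g (h (k, n)) = (k, n)" for k n
    proof (cases "even n")
      case True
      then show ?thesis by (auto simp: h_def g_def Let_def elim!: evenE)
    next
      case False
      then obtain j where n: "n = 2 * j + 1" by (rule oddE)
      have "(- 2 * k - 1 + n) div 2 = j - k" "(- 2 * k - 1 - n) div 2 = - k - j - 1"
        using n by presburger+
      then have "h (k, n) = (j - k, - k - j - 1)"
        using n by (simp add: h_def Let_def)
      moreover have "odd (j - k + (- k - j - 1))" "- (j - k + (- k - j - 1) + 1) div 2 = k"
        by presburger+
      ultimately show ?thesis using n by (simp add: g_def del: even_add even_diff)
    qed
    show "h (g (x, y)) = (x, y)" for x y
    proof (cases "even (x + y)")
      case True
      then obtain j where "x = 2 * j - y" by (metis add_diff_cancel_right' evenE)
      then show ?thesis by (simp add: h_def g_def Let_def)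
    next
      case False
      then obtain j where "x = 2 * j + 1 - y" by (metis add_diff_cancel_right' oddE)
      then show ?thesis by (simp add: h_def g_def Let_def)
    qed
  qed auto
  have "theta_exp (4 * w) (2 * w) k + theta_exp w (b - w) n =
      (case h (k, n) of (x, y) \<Rightarrow> theta_exp (2 * w) b x + theta_exp (2 * w) (2 * w - b) y)" for k n
  proof -
    obtain x y where xy: "h (k, n) = (x, y)" by fastforce
    have half: "(u + n) div 2 + (u - n) div 2 = u \<and> (u + n) div 2 - (u - n) div 2 = n"
      if "even u \<longleftrightarrow> even n" for u
      using that by presburger
    define u where "u = (if even n then 2 * k else - 2 * k - 1)"
    have "x = (u + n) div 2" "y = (u - n) div 2" "even u \<longleftrightarrow> even n"
      using xy by (simp_all add: h_def u_def Let_def)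
    then have n: "n = x - y" and u: "u = x + y"
      using half[of u] by simp_all
    have "2 * k = x + y \<or> - 2 * k - 1 = x + y"
      unfolding u[symmetric] by (simp add: u_def)
    then have k: "(2 * k) * (2 * k + 1) = (x + y) * (x + y + 1)"
    proof
      assume "- 2 * k - 1 = x + y"
      then have "x + y + 1 = - (2 * k)" "x + y = - (2 * k + 1)" by simp_all
      then show ?thesis by (simp only: minus_mult_minus mult.commute)
    qed simp
    have "4 * w * k\<^sup>2 + 2 * w * k + (w * n\<^sup>2 + (b - w) * n)
        = w * ((2 * k) * (2 * k + 1)) + (w * n\<^sup>2 + (b - w) * n)"
      by (simp add: algebra_simps power2_eq_square)
    also have "\<dots> = 2 * w * x\<^sup>2 + b * x + (2 * w * y\<^sup>2 + (2 * w - b) * y)"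
      unfolding k n by (simp add: algebra_simps power2_eq_square)
    finally have "2 * int (theta_exp (4 * w) (2 * w) k) + 2 * int (theta_exp w (b - w) n)
      = 2 * int (theta_exp (2 * w) b x) + 2 * int (theta_exp (2 * w) (2 * w - b) y)"
      using assms by (subst (1 2 3 4) two_theta_exp) auto
    then show ?thesis using xy by simp
  qed
  then have "count_fps UNIV (\<lambda>(k, n). theta_exp (4 * w) (2 * w) k + theta_exp w (b - w) n)
      = (count_fps UNIV (\<lambda>(x, y). theta_exp (2 * w) b x + theta_exp (2 * w) (2 * w - b) y) :: bit fps)"
    by (intro count_fps_reindex[OF bij]) auto
  then show ?thesis
    using assms by (subst (1 2) theta_mult) auto
qed

text \<open>Even indices contribute \<theta>(40, 16), odd ones q \<theta>(40, 24); squaring twice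
  shows that both are fourth powers.\<close>

lemma theta_10_8_split: "theta 10 8 = theta 10 4 ^ 4 + fps_X * theta 10 6 ^ 4"
proof -
  let ?E = "{n::int. even n}" and ?O = "{n::int. odd n}"
  have "theta 10 8 = count_fps (?E \<union> ?O) (theta_exp 10 8)"
    unfolding theta_def by (rule arg_cong[of _ _ "\<lambda>I. count_fps I (theta_exp 10 8)"]) auto
  also have "\<dots> = count_fps ?E (theta_exp 10 8) + count_fps ?O (theta_exp 10 8)"
    by (intro count_fps_Un finite_theta_exp) auto
  also have "count_fps ?E (theta_exp 10 8) = theta 40 16"
    unfolding theta_def
  proof (rule count_fps_reindex[of "\<lambda>n. 2 * n", symmetric])
    show "bij_betw (\<lambda>n. 2 * n) UNIV ?E"
      by (rule bij_betw_byWitness[of _ "\<lambda>n. n div 2"]) auto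
    show "theta_exp 10 8 (2 * n) = theta_exp 40 16 n" for n
      by (simp add: theta_exp_def)
  qed
  \<comment> \<open>The reflected index keeps the linear coefficient, 24, below 40; with
    \<open>2 * n + 1\<close> it would be 56.\<close>
  also have "count_fps ?O (theta_exp 10 8) = count_fps UNIV (\<lambda>n. theta_exp 40 24 n + 1)"
  proof (rule count_fps_reindex[of "\<lambda>n. - 2 * n - 1", symmetric])
    show "bij_betw (\<lambda>n. - 2 * n - 1) UNIV ?O"
      by (rule bij_betw_byWitness[of _ "\<lambda>n. - (n + 1) div 2"]) (auto; presburger)+
    show "theta_exp 10 8 (- 2 * n - 1) = theta_exp 40 24 n + 1" for n
    proof -
      have "2 * int (theta_exp 10 8 (- 2 * n - 1)) = 2 * int (theta_exp 40 24 n) + 2"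
        by (subst (1 2) two_theta_exp) (auto simp: algebra_simps power2_eq_square)
      then show ?thesis by linarith
    qed
  qed
  also have "\<dots> = fps_X * theta 40 24"
    using count_fps_shift[of UNIV "theta_exp 40 24" 1] by (simp add: theta_def)
  also have "theta 40 16 = theta 10 4 ^ 4"
    using theta_square[of 4 10] theta_square[of 8 20] power_mult[of "theta 10 4" 2 2] by simp
  also have "theta 40 24 = theta 10 6 ^ 4"
    using theta_square[of 6 10] theta_square[of 12 20] power_mult[of "theta 10 6" 2 2] by simp
  finally show ?thesis .
qed

text \<open>Multiplication by \<open>2 + \<i>\<close> in the Gaussian integers: \<open>\<psi>\<^sup>2\<close> enumerates \<open>X + Y\<i>\<close> with
  \<open>X \<equiv> Y \<equiv> 1 (mod 4)\<close>; those for which \<open>(2 + \<i>)(X + Y\<i>)\<close> is divisible by \<open>5\<close> contribute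
  \<open>q P\<^sup>2\<close>, and for the others a unique associate \<open>U + V\<i>\<close> of \<open>(2 + \<i>)(X + Y\<i>)\<close> has
  \<open>U \<equiv> 3, V \<equiv> -1 (mod 10)\<close>, so they contribute \<open>a b\<close>. Here \<open>X = 4 m + 1\<close>,
  \<open>Y = 4 n + 1\<close>, \<open>U = 10 x + 3\<close>, \<open>V = - 10 y - 1\<close>; the four cases are the four units.\<close>

lemma psi_square_split:
  "(theta 4 2)\<^sup>2 = theta 5 3 * theta 5 1 + fps_X * (theta 20 10)\<^sup>2"
proof -
  let ?e = "\<lambda>(m, n). theta_exp 4 2 m + theta_exp 4 2 n"
  let ?N = "{(m, n). (2 * m - n) mod 5 \<noteq> (1 :: int)}" and ?D = "{(m, n). (2 * m - n) mod 5 = (1 :: int)}"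
  define h :: "int \<times> int \<Rightarrow> int \<times> int" where "h = (\<lambda>(x, y).
     if even x then if even y then (y + x div 2, x - y div 2)
                    else (- x + (y - 1) div 2, y + x div 2)
     else if even y then (x - y div 2, - y - (x + 1) div 2)
          else (- y - (x + 1) div 2, - x + (y - 1) div 2))"
  \<comment> \<open>Here (2 + i)(X + Yi) = (4 r + 1) + (4 s + 3) i and s is congruent to 3 r modulo
    5, so \<open>r mod 5\<close> alone selects the unit. Residue 1 is the divisible case; on
    \<open>?N\<close> the last branch therefore means residue 4.\<close>
  define g :: "int \<times> int \<Rightarrow> int \<times> int" where "g = (\<lambda>(m, n).
     let r = 2 * m - n; s = m + 2 * n in
     if r mod 5 = 0 then (2 * s div 5, 2 * r div 5)
     else if r mod 5 = 2 then (- (2 * s + 3) div 5, - (2 * r + 1) div 5)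
     else if r mod 5 = 3 then ((2 * r - 1) div 5, - (2 * s + 2) div 5)
     else (- (2 * r + 2) div 5, (2 * s + 1) div 5))"
  \<comment> \<open>Multiplication of (4 m + 1) + (4 n + 1) i by 2 + i, then conjugation, which
    makes both components 1 modulo 4 again. The norm grows by the factor 5, whence the shift by 1 in
    \<open>e'\<close>: 5 * 2 = 2 + 8.\<close>
  define h' :: "int \<times> int \<Rightarrow> int \<times> int" where "h' = (\<lambda>(m, n). (2 * m - n, - m - 2 * n - 1))"
  define g' :: "int \<times> int \<Rightarrow> int \<times> int" where
    "g' = (\<lambda>(m, n). ((2 * m - n - 1) div 5, - (m + 2 * n + 2) div 5))"

  have h: "h (2 * s, 2 * t) = (2 * t + s, 2 * s - t)"
    "h (2 * s, 2 * t + 1) = (t - 2 * s, 2 * t + 1 + s)"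
    "h (2 * s + 1, 2 * t) = (2 * s + 1 - t, - 2 * t - s - 1)"
    "h (2 * s + 1, 2 * t + 1) = (- 2 * t - s - 2, t - 2 * s - 1)" for s t
    by (simp_all add: h_def)
  have parities: "P x y" if "\<And>s t. P (2 * s) (2 * t)" "\<And>s t. P (2 * s) (2 * t + 1)"
    "\<And>s t. P (2 * s + 1) (2 * t)" "\<And>s t. P (2 * s + 1) (2 * t + 1)"
    for P :: "int \<Rightarrow> int \<Rightarrow> bool" and x y
    using that by (metis evenE oddE)
  have g0: "g (m, n) = (2 * b, 2 * a)"
    if r: "2 * m - n = 5 * a" and s: "m + 2 * n = 5 * b" for m n a b
    unfolding g_def Let_def prod.case r s by simp
  have g2: "g (m, n) = (- 2 * b - 1, - 2 * a - 1)"
    if r: "2 * m - n = 5 * a + 2" and s: "m + 2 * n = 5 * b + 1" for m n a b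
  proof -
    have "(5 * a + 2) mod 5 = 2" "- (2 * (5 * b + 1) + 3) div 5 = - 2 * b - 1"
      "- (2 * (5 * a + 2) + 1) div 5 = - 2 * a - 1"
      by presburger+
    then show ?thesis
      unfolding g_def Let_def prod.case r s by simp
  qed
  have g3: "g (m, n) = (2 * a + 1, - 2 * b - 2)"
    if r: "2 * m - n = 5 * a + 3" and s: "m + 2 * n = 5 * b + 4" for m n a b
  proof -
    have "(5 * a + 3) mod 5 = 3" "(2 * (5 * a + 3) - 1) div 5 = 2 * a + 1"
      "- (2 * (5 * b + 4) + 2) div 5 = - 2 * b - 2"
      by presburger+
    then show ?thesis
      unfolding g_def Let_def prod.case r s by simp
  qed
  have g4: "g (m, n) = (- 2 * a - 2, 2 * b + 1)"
    if r: "2 * m - n = 5 * a + 4" and s: "m + 2 * n = 5 * b + 2" for m n a b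
  proof -
    have "(5 * a + 4) mod 5 = 4" "- (2 * (5 * a + 4) + 2) div 5 = - 2 * a - 2"
      "(2 * (5 * b + 2) + 1) div 5 = 2 * b + 1"
      by presburger+
    then show ?thesis
      unfolding g_def Let_def prod.case r s by simp
  qed
  have bij: "bij_betw h UNIV ?N"
  proof (rule bij_betw_byWitness[of _ g]; (intro ballI subsetI)?)
    have gh: "g (h (x, y)) = (x, y) \<and> h (x, y) \<in> ?N" for x y
    proof (rule parities[of "\<lambda>x y. g (h (x, y)) = (x, y) \<and> h (x, y) \<in> ?N"])
      fix s t
      show "g (h (2 * s, 2 * t)) = (2 * s, 2 * t) \<and> h (2 * s, 2 * t) \<in> ?N"
        by (simp add: h g0[of _ _ t s])
      have "(2 * (t - 2 * s) - (2 * t + 1 + s)) mod 5 \<noteq> 1"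
        by presburger
      then show "g (h (2 * s, 2 * t + 1)) = (2 * s, 2 * t + 1) \<and> h (2 * s, 2 * t + 1) \<in> ?N"
        by (simp add: h g4[of _ _ "- s - 1" t])
      have "(2 * (2 * s + 1 - t) - (- 2 * t - s - 1)) mod 5 \<noteq> 1"
        by presburger
      then show "g (h (2 * s + 1, 2 * t)) = (2 * s + 1, 2 * t) \<and> h (2 * s + 1, 2 * t) \<in> ?N"
        by (simp add: h g3[of _ _ s "- t - 1"])
      have "(2 * (- 2 * t - s - 2) - (t - 2 * s - 1)) mod 5 \<noteq> 1"
        by presburger
      then show "g (h (2 * s + 1, 2 * t + 1)) = (2 * s + 1, 2 * t + 1) \<and> h (2 * s + 1, 2 * t + 1) \<in> ?N"
        by (simp add: h g2[of _ _ "- t - 1" "- s - 1"])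
    qed
    show "g (h z) = z" for z
      using gh by (cases z) blast
    show "z \<in> ?N" if zh: "z \<in> h ` UNIV" for z
    proof -
      obtain x y where "z = h (x, y)" using zh by fastforce
      then show ?thesis using gh[of x y] by (simp only:)
    qed
    show "h (g z) = z" if "z \<in> ?N" for z
    proof -
      obtain m n where z: "z = (m, n)" by fastforce
      define a where "a = (2 * m - n) div 5"
      have "(2 * m - n) mod 5 \<noteq> 1"
        using that z by simp
      then consider "n = 2 * m - 5 * a" | "n = 2 * m - 5 * a - 2" | "n = 2 * m - 5 * a - 3"
        | "n = 2 * m - 5 * a - 4"
        unfolding a_def by atomize_elim presburger
      then show ?thesis
      proof cases
        case 1
        then have "g (m, n) = (2 * (m - 2 * a), 2 * a)"
          using g0[of m n a "m - 2 * a"] by simp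
        then show ?thesis
          unfolding z by (simp only: h) (simp add: 1)
      next
        case 2
        then have "g (m, n) = (2 * (2 * a - m) + 1, 2 * (- a - 1) + 1)"
          using g2[of m n a "m - 2 * a - 1"] by simp
        then show ?thesis
          unfolding z by (simp only: h) (simp add: 2)
      next
        case 3
        then have "g (m, n) = (2 * a + 1, 2 * (2 * a - m + 1))"
          using g3[of m n a "m - 2 * a - 2"] by simp
        then show ?thesis
          unfolding z by (simp only: h) (simp add: 3)
      next
        case 4
        then have "g (m, n) = (2 * (- a - 1), 2 * (m - 2 * a - 2) + 1)"
          using g4[of m n a "m - 2 * a - 2"] by simp
        then show ?thesis
          unfolding z by (simp only: h) (simp add: 4)
      qed
    qed
  qed simp
  have e: "?e (h (x, y)) = theta_exp 5 3 x + theta_exp 5 1 y" for x y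
  proof -
    have "case h (x, y) of (m, n) \<Rightarrow> 2 * (4 * m\<^sup>2 + 2 * m) + 2 * (4 * n\<^sup>2 + 2 * n)
        = 2 * (5 * x\<^sup>2 + 3 * x) + 2 * (5 * y\<^sup>2 + y)"
      by (rule parities[of _ x y]) (simp_all only: h prod.case, simp_all add: algebra_simps power2_eq_square)
    then have "case h (x, y) of (m, n) \<Rightarrow> 2 * int (theta_exp 4 2 m) + 2 * int (theta_exp 4 2 n)
       = 2 * int (theta_exp 5 3 x) + 2 * int (theta_exp 5 1 y)"
      by (simp add: two_theta_exp split: prod.splits)
    then show ?thesis by (auto split: prod.splits)
  qed
  have bij': "bij_betw h' UNIV ?D"
  proof (rule bij_betw_byWitness[of _ g']; (intro ballI subsetI)?)
    show "g' (h' z) = z" for z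
      by (cases z) (simp add: h'_def g'_def)
    show "h' (g' z) = z" if "z \<in> ?D" for z
    proof -
      obtain m n where z: "z = (m, n)" by fastforce
      define a where "a = (2 * m - n) div 5"
      have "n = 2 * m - 5 * a - 1"
        using that z unfolding a_def by simp presburger
      then have "g' z = (a, 2 * a - m)"
        by (simp add: z g'_def)
      then show ?thesis
        using \<open>n = _\<close> by (simp add: z h'_def)
    qed
    show "z \<in> ?D" if "z \<in> h' ` UNIV" for z
      using that by (auto simp: h'_def)
  qed simp
  have e': "?e (h' (m, n)) = (theta_exp 20 10 m + theta_exp 20 10 n) + 1" for m n
  proof -
    have "2 * int (theta_exp 4 2 (2 * m - n)) + 2 * int (theta_exp 4 2 (- m - 2 * n - 1))
       = 2 * int (theta_exp 20 10 m) + 2 * int (theta_exp 20 10 n) + 2"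
      by (subst (1 2 3 4) two_theta_exp) (auto simp: algebra_simps power2_eq_square)
    then show ?thesis by (simp add: h'_def)
  qed
  have fin: "finite {i \<in> I. ?e i = k}" for I k
  proof (rule finite_subset)
    show "{i \<in> I. ?e i = k} \<subseteq> {m. theta_exp 4 2 m \<le> k} \<times> {n. theta_exp 4 2 n \<le> k}"
      by auto
    have "{m. theta_exp 4 2 m \<le> k} = (\<Union>j\<in>{..k}. {m\<in>UNIV. theta_exp 4 2 m = j})"
      by auto
    then have "finite {m. theta_exp 4 2 m \<le> k}"
      by (simp only:) (intro finite_UN_I finite_theta_exp; simp)
    then show "finite ({m. theta_exp 4 2 m \<le> k} \<times> {n. theta_exp 4 2 n \<le> k})"
      by simp
  qed
  have "(theta 4 2)\<^sup>2 = count_fps (?N \<union> ?D) ?e"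
    unfolding power2_eq_square by (subst theta_mult) (auto intro!: arg_cong[of _ _ "\<lambda>I. count_fps I ?e"])
  also have "\<dots> = count_fps ?N ?e + count_fps ?D ?e"
    by (intro count_fps_Un fin) auto
  also have "count_fps ?N ?e = theta 5 3 * theta 5 1"
    using e by (subst theta_mult) (auto intro!: count_fps_reindex[OF bij, symmetric])
  also have "count_fps ?D ?e = count_fps UNIV (\<lambda>x. (case x of (m, n) \<Rightarrow> theta_exp 20 10 m + theta_exp 20 10 n) + 1)"
    using e' by (intro count_fps_reindex[OF bij', symmetric]) auto
  also have "\<dots> = fps_X * (theta 20 10)\<^sup>2"
    unfolding count_fps_shift power2_eq_square by (subst theta_mult) auto
  finally show ?thesis .
qed

section \<open>The generating function of \<open>c_coeff 9 1\<close> modulo 2\<close>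

lemma c_coeff_mod_2: "Abs_fps (\<lambda>n. of_int (c_coeff 9 1 n)) * theta 10 8 = 1"
proof (rule fps_ext)
  fix n
  have theta: "of_int (fps_nth (false_theta_q 9 1) m) = fps_nth (theta 10 8) m" for m
  proof -
    have e: "false_theta_exp 9 1 k = theta_exp 10 8 k" for k
    proof -
      have "0 \<le> k * (k + 1)" "0 \<le> k * (k - 1)"
        by (auto simp: zero_le_mult_iff)
      then have "2 * int (false_theta_exp 9 1 k) = 9 * (k * (k + 1)) + k * (k - 1)"
        by (simp add: false_theta_exp_def)
      also have "\<dots> = 2 * int (theta_exp 10 8 k)"
        by (subst two_theta_exp) (auto simp: algebra_simps power2_eq_square)
      finally show ?thesis by simp
    qed
    let ?P = "{k. k \<ge> 0 \<and> theta_exp 10 8 k = m}" and ?Q = "{k. k \<le> -1 \<and> theta_exp 10 8 k = m}"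
    have fin: "finite ?P" "finite ?Q"
      using finite_theta_exp[of 8 10 "{0..}" m] finite_theta_exp[of 8 10 "{..-1}" m] by simp_all
    \<comment> \<open>All signs, including the one that makes the theta function false, disappear in
      \<open>bit\<close>.\<close>
    have "of_int (fps_nth (false_theta_q 9 1) m) = (of_nat (card ?P) + of_nat (card ?Q) :: bit)"
      by (simp add: false_theta_q_nth e del: One_nat_def)
    also have "card ?P + card ?Q = card {k. theta_exp 10 8 k = m}"
      using fin by (subst card_Un_disjoint[symmetric]) (auto intro!: arg_cong[of _ _ card])
    then have "of_nat (card ?P) + of_nat (card ?Q) = (of_nat (card {k. theta_exp 10 8 k = m}) :: bit)"
      unfolding of_nat_add[symmetric] by (rule arg_cong)
    finally show ?thesis
      by (simp add: theta_def count_fps_def)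
  qed
  have "fps_nth (Abs_fps (\<lambda>n. of_int (c_coeff 9 1 n)) * theta 10 8) n
      = of_int (fps_nth (Abs_fps (c_coeff 9 1) * false_theta_q 9 1) n)"
    by (simp only: fps_mult_nth of_int_sum of_int_mult theta fps_nth_Abs_fps)
  also have "\<dots> = fps_nth 1 n"
    by (simp add: c_coeff_generating_function)
  finally show "fps_nth (Abs_fps (\<lambda>n. of_int (c_coeff 9 1 n)) * theta 10 8) n = fps_nth (1 :: bit fps) n" .
qed

lemma inverse_theta_10_8_nth:
  assumes C: "C * theta 10 8 = 1"
  shows "fps_nth C (8 * n + 2) = fps_nth (theta 5 1 * theta 4 2) n"
    and "fps_nth C (8 * n + 6) = fps_nth (theta 5 1 * theta 20 10) n"
proof -
  let ?A = "theta 10 8" and ?B = "theta 10 4" and ?D = "theta 10 6"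
  let ?a = "theta 5 3" and ?b = "theta 5 1" and ?P = "theta 20 10"
  have D: "?D = ?a\<^sup>2" and b2: "theta 10 2 = ?b\<^sup>2"
    by (simp_all add: theta_square)
  have Ab: "?A * ?b\<^sup>2 = ?P * ?a"
    using theta_mult_rearrange[of 8 5] b2 by simp
  have Ba: "?B * ?a\<^sup>2 = ?P * ?b"
    using theta_mult_rearrange[of 6 5] D by (simp add: mult.commute)
  \<comment> \<open>Multiplying by \<open>?A\<close> removes \<open>C\<close>; afterwards
    \<open>?A\<close> is cancelled, the power series forming a domain.\<close>
  have "?A * (C * ?B * ?D\<^sup>2) = ?B * ?D\<^sup>2"
    using C by (simp add: algebra_simps)
  also have "\<dots> = (?B * ?a\<^sup>2) * ?a\<^sup>2"
    by (simp add: D power2_eq_square algebra_simps)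
  also have "\<dots> = ?A * ?b\<^sup>2 * (?a * ?b)"
    unfolding Ba Ab by (simp add: power2_eq_square algebra_simps)
  finally have "?A * (C * ?B * ?D\<^sup>2) = ?A * (?b\<^sup>2 * (?a * ?b))"
    by (simp add: mult.assoc)
  moreover have "?A \<noteq> 0" using C by auto
  ultimately have "C * ?B * ?D\<^sup>2 = ?b\<^sup>2 * (?a * ?b)"
    by simp
  also have "?a * ?b = (theta 4 2)\<^sup>2 + fps_X * ?P\<^sup>2"
    unfolding psi_square_split by (simp add: add.assoc)
  finally have S: "C * ?B * ?D\<^sup>2 = (?b * theta 4 2)\<^sup>2 + fps_X * (?b * ?P)\<^sup>2"
    by (simp add: power_mult_distrib algebra_simps)

  \<comment> \<open>\<open>C ^ 4\<close> has only exponents divisible by 4, so the residues of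
    exponents modulo 4 come from \<open>?A ^ 3\<close>, where \<open>theta_10_8_split\<close>
    separates them.\<close>
  have "C = C ^ 4 * ?A ^ 3"
  proof -
    have "C ^ 4 * ?A ^ 3 = C * (C * ?A) ^ 3"
      by (simp add: power_mult_distrib power4_eq_xxxx power3_eq_cube mult.assoc)
    then show ?thesis by (simp add: C)
  qed
  also have "?A ^ 3 = ?A\<^sup>2 * ?A"
    by (simp add: power2_eq_square power3_eq_cube)
  also have "?A\<^sup>2 = ?B ^ 8 + fps_X\<^sup>2 * ?D ^ 8"
  proof -
    have "(2 :: bit fps) = 0"
      using bit_fps_add_self[of 1] by simp
    then have "(x + y)\<^sup>2 = x\<^sup>2 + y\<^sup>2" for x y :: "bit fps"
      by (simp only: power2_sum) simp
    then show ?thesis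
      unfolding theta_10_8_split by (simp add: power_mult_distrib)
  qed
  also have "C ^ 4 * ((?B ^ 8 + fps_X\<^sup>2 * ?D ^ 8) * ?A) =
      (C * ?B ^ 3) ^ 4 + fps_X ^ 1 * (C * ?B\<^sup>2 * ?D) ^ 4
      + fps_X ^ 2 * (C * ?B * ?D\<^sup>2) ^ 4 + fps_X ^ 3 * (C * ?D ^ 3) ^ 4"
  proof -
    have "c ^ 4 * ((u ^ 8 + x\<^sup>2 * v ^ 8) * (u ^ 4 + x * v ^ 4)) =
      (c * u ^ 3) ^ 4 + x ^ 1 * (c * u\<^sup>2 * v) ^ 4 + x ^ 2 * (c * u * v\<^sup>2) ^ 4 + x ^ 3 * (c * v ^ 3) ^ 4"
      for c u v x :: "bit fps"
      by (simp add: eval_nat_numeral algebra_simps)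
    then show ?thesis unfolding theta_10_8_split .
  qed
  finally have C4: "fps_nth C (4 * m + 2) = fps_nth (C * ?B * ?D\<^sup>2) m" for m
  proof -
    assume eq: "C = (C * ?B ^ 3) ^ 4 + fps_X ^ 1 * (C * ?B\<^sup>2 * ?D) ^ 4
      + fps_X ^ 2 * (C * ?B * ?D\<^sup>2) ^ 4 + fps_X ^ 3 * (C * ?D ^ 3) ^ 4"
    \<comment> \<open>Only the term with \<open>fps_X ^ 2\<close> survives. The alternative
      \<open>4 * m + 2 < 3\<close> is for \<open>m = 0\<close>, where the truncated difference is 0
      and thus divisible by 4.\<close>
    have "\<not> 4 dvd 4 * m + 2" "\<not> 4 dvd 4 * m + 2 - 1"
      "4 * m + 2 < 3 \<or> \<not> 4 dvd 4 * m + 2 - 3"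
      by presburger+
    with arg_cong[OF eq, of "\<lambda>F. fps_nth F (4 * m + 2)"] show ?thesis
      unfolding fps_add_nth fps_X_power_mult_nth bit_fps_fourth_power_nth by auto
  qed
  \<comment> \<open>In \<open>S\<close> an even index meets only the first square, an odd index only
    the second.\<close>
  have *: "8 * n + 2 = 4 * (2 * n) + 2" "8 * n + 6 = 4 * (2 * n + 1) + 2" by simp_all
  show "fps_nth C (8 * n + 2) = fps_nth (theta 5 1 * theta 4 2) n"
    unfolding * C4 S using bit_fps_square_nth[of "?b * ?P" "2 * n - 1"]
    by (simp add: bit_fps_square_nth fps_X_mult_nth)
  show "fps_nth C (8 * n + 6) = fps_nth (theta 5 1 * theta 20 10) n"
    unfolding * C4 S by (simp add: bit_fps_square_nth)
qed

section \<open>Representations by binary quadratic forms\<close>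

text \<open>Otherwise raising x^2 = -y^2 to the odd power (p - 1) / 2 would give 1 = -1 modulo p by
  Fermat's theorem.\<close>

lemma prime_3_mod_4_dvd_sum_squares:
  fixes p :: nat and x y :: int
  assumes "prime p" "[p = 3] (mod 4)" "int p dvd x\<^sup>2 + y\<^sup>2"
  shows "int p dvd x"
proof (rule ccontr)
  assume "\<not> int p dvd x"
  moreover have "prime (int p)"
    using assms(1) by simp
  ultimately have "\<not> int p dvd y"
    using assms(3) prime_dvd_power[of "int p" x 2]
    by (auto simp: dvd_add_left_iff power2_eq_square)
  define m where "m = (p - 1) div 2"
  have p: "p mod 4 = 3" "p > 2"
    using assms(2) prime_ge_2_nat[OF assms(1)] by (auto simp: cong_def le_less)
  have m: "2 * m = p - 1" "odd m"
    using p unfolding m_def by presburger+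
  have fermat: "[z ^ (p - 1) = 1] (mod int p)" if "\<not> int p dvd z" for z
  proof -
    have "[nat \<bar>z\<bar> ^ (p - 1) = 1] (mod p)"
      using that by (intro fermat_theorem assms) (simp flip: int_dvd_int_iff)
    then have "[\<bar>z\<bar> ^ (p - 1) = 1] (mod int p)"
      using cong_int_iff[of "nat \<bar>z\<bar> ^ (p - 1)" 1 p] by simp
    moreover have "\<bar>z\<bar> ^ (p - 1) = z ^ (p - 1)"
      by (rule power_even_abs) (metis dvd_triv_left m(1))
    ultimately show ?thesis by simp
  qed
  have "[x\<^sup>2 = - (y\<^sup>2)] (mod int p)"
    using assms(3) by (simp add: cong_iff_dvd_diff)
  then have "[(x\<^sup>2) ^ m = (- (y\<^sup>2)) ^ m] (mod int p)"
    by (rule cong_pow)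
  then have "[x ^ (p - 1) = - (y ^ (p - 1))] (mod int p)"
    using m by (simp add: power_mult [symmetric])
  moreover have "[- (y ^ (p - 1)) = - 1] (mod int p)"
    using fermat[OF \<open>\<not> int p dvd y\<close>] by (simp add: cong_minus_minus_iff)
  ultimately have "[1 = -1] (mod int p)"
    using fermat[OF \<open>\<not> int p dvd x\<close>] by (meson cong_sym cong_trans)
  then have "int p dvd 2"
    by (simp add: cong_iff_dvd_diff)
  then show False
    using p zdvd_imp_le[of "int p" 2] by simp
qed

text \<open>Descent: modulo p the form is x^2 + (b y)^2, so p divides both x and y, and dividing by
  p^2 lowers the exponent by 2. At exponent 1 it would follow that p divides m.\<close>

lemma quadratic_form_odd_power_not_represented:
  fixes p k :: nat and d m x y :: int
  assumes p: "prime p" "[p = 3] (mod 4)" and b: "[b\<^sup>2 = d] (mod int p)" "\<not> int p dvd d"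
    and m: "\<not> int p dvd m" and rep: "x\<^sup>2 + d * y\<^sup>2 = int p ^ (2 * k + 1) * m"
  shows False
  using rep
proof (induction k arbitrary: x y)
  have prime: "prime (int p)" using p by simp
  have *: "int p dvd x \<and> int p dvd y" if "int p dvd x\<^sup>2 + d * y\<^sup>2" for x y
  proof -
    have "[x\<^sup>2 + (b * y)\<^sup>2 = x\<^sup>2 + d * y\<^sup>2] (mod int p)"
      using b(1) by (simp add: power_mult_distrib cong_add cong_mult)
    then have dvd: "int p dvd x\<^sup>2 + (b * y)\<^sup>2"
      using that cong_dvd_iff by blast
    have "int p dvd x" "int p dvd b * y"
      using prime_3_mod_4_dvd_sum_squares[OF p dvd]
        prime_3_mod_4_dvd_sum_squares[OF p, of "b * y" x] dvd by (simp_all add: add.commute)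
    moreover have "\<not> int p dvd b"
    proof
      assume "int p dvd b"
      then have "int p dvd b\<^sup>2" by (simp add: power2_eq_square)
      with b show False using cong_dvd_iff by blast
    qed
    ultimately show ?thesis
      using prime prime_dvd_mult_iff by blast
  qed
  have desc: "\<exists>x' y'. int p ^ (2 * k + 1) * m = int p * int p * (x'\<^sup>2 + d * y'\<^sup>2)"
    if "x\<^sup>2 + d * y\<^sup>2 = int p ^ (2 * k + 1) * m" for x y k
  proof -
    have "int p dvd x" "int p dvd y"
      using *[of x y] that by auto
    then obtain x' y' where "x = int p * x'" "y = int p * y'" by (auto elim!: dvdE)
    with that show ?thesis
      by (intro exI[of _ x'] exI[of _ y']) (simp add: algebra_simps power2_eq_square)
  qed
  have p0: "int p \<noteq> 0" using p by auto
  {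
    case 0
    from desc[OF this] obtain z where "int p * m = int p * int p * z" by auto
    then show ?case using m p0 by auto
  next
    case (Suc k)
    from desc[OF Suc.prems] obtain x' y' where
      "int p ^ (2 * Suc k + 1) * m = int p * int p * (x'\<^sup>2 + d * y'\<^sup>2)" by blast
    then have "x'\<^sup>2 + d * y'\<^sup>2 = int p ^ (2 * k + 1) * m"
      using p0 by (simp add: mult.assoc)
    then show ?case by (rule Suc.IH)
  }
qed

text \<open>By reciprocity, since p is 1^2 or 2^2 modulo 5 and the sign is trivial because (5 - 1) /
  2 is even.\<close>

lemma five_quadratic_residue:
  fixes p :: nat
  assumes "prime p" "p > 2" "p mod 5 = 1 \<or> p mod 5 = 4"
  obtains b where "[b\<^sup>2 = 5] (mod int p)"
proof -
  have p5: "p \<noteq> 5" using assms by auto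
  have "QuadRes 5 (int p)"
  proof -
    have "[1\<^sup>2 = int p] (mod 5) \<or> [2\<^sup>2 = int p] (mod 5)"
      using assms(3) unfolding cong_def by simp_all presburger
    then show ?thesis unfolding QuadRes_def by blast
  qed
  moreover have "\<not> [int p = 0] (mod 5)"
    using assms(3) unfolding cong_def by simp_all presburger
  ultimately have "Legendre (int p) 5 = 1"
    by (simp add: Legendre_def)
  moreover have "Legendre (int p) (int 5) * Legendre (int 5) (int p) = (-1) ^ ((p - 1) div 2 * ((5 - 1) div 2))"
    using assms p5 by (intro Quadratic_Reciprocity) auto
  ultimately have "Legendre 5 (int p) = 1"
    by simp
  then have "QuadRes (int p) 5"
    by (auto simp: Legendre_def split: if_splits)
  then show ?thesis using that unfolding QuadRes_def by blast
qed

section \<open>Even coefficients from missing representations\<close>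

lemma c_coeff_8n_plus_2_even:
  assumes "\<And>x y. x\<^sup>2 + 5 * y\<^sup>2 \<noteq> 40 * int n + 6"
  shows "[c_coeff 9 1 (8 * n + 2) = 0] (mod 2)"
proof -
  have "theta_exp 5 1 x + theta_exp 4 2 y \<noteq> n" for x y
  proof
    assume "theta_exp 5 1 x + theta_exp 4 2 y = n"
    then have "2 * int (theta_exp 5 1 x) + 2 * int (theta_exp 4 2 y) = 2 * int n"
      by simp
    \<comment> \<open>Completing squares: \<open>40 * theta_exp 5 1 x + 1\<close> is (10 x + 1)^2
      and \<open>40 * theta_exp 4 2 y + 5\<close> is 5 (4 y + 1)^2.\<close>
    then have "(10 * x + 1)\<^sup>2 + 5 * (4 * y + 1)\<^sup>2 = 40 * int n + 6"
      by (simp add: two_theta_exp) (simp add: algebra_simps power2_eq_square)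
    with assms show False by blast
  qed
  then have empty: "{z. (case z of (x, y) \<Rightarrow> theta_exp 5 1 x + theta_exp 4 2 y) = n} = {}"
    by auto
  have "fps_nth (theta 5 1 * theta 4 2) n = 0"
    by (simp add: theta_mult count_fps_def empty)
  then have "even (c_coeff 9 1 (8 * n + 2))"
    using inverse_theta_10_8_nth(1)[OF c_coeff_mod_2, of n] even_of_int_iff[where 'a = bit] by simp
  then show ?thesis by (simp add: cong_0_iff)
qed

lemma c_coeff_8n_plus_6_even:
  assumes "\<And>x y. x\<^sup>2 + y\<^sup>2 \<noteq> 40 * int n + 26"
  shows "[c_coeff 9 1 (8 * n + 6) = 0] (mod 2)"
proof -
  have "theta_exp 5 1 x + theta_exp 20 10 y \<noteq> n" for x y
  proof
    assume "theta_exp 5 1 x + theta_exp 20 10 y = n"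
    then have "2 * int (theta_exp 5 1 x) + 2 * int (theta_exp 20 10 y) = 2 * int n"
      by simp
    \<comment> \<open>The factor 25 of 25 (4 y + 1)^2 is absorbed into the square, leaving a plain
      sum of two squares.\<close>
    then have "(10 * x + 1)\<^sup>2 + (20 * y + 5)\<^sup>2 = 40 * int n + 26"
      by (simp add: two_theta_exp) (simp add: algebra_simps power2_eq_square)
    with assms show False by blast
  qed
  then have empty: "{z. (case z of (x, y) \<Rightarrow> theta_exp 5 1 x + theta_exp 20 10 y) = n} = {}"
    by auto
  have "fps_nth (theta 5 1 * theta 20 10) n = 0"
    by (simp add: theta_mult count_fps_def empty)
  then have "even (c_coeff 9 1 (8 * n + 6))"
    using inverse_theta_10_8_nth(2)[OF c_coeff_mod_2, of n] even_of_int_iff[where 'a = bit] by simp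
  then show ?thesis by (simp add: cong_0_iff)
qed

theorem theorem2p1:
  fixes p :: nat
  assumes "prime p"
    and "[p = 11] (mod 20) \<or> [p = 19] (mod 20)"
  shows "\<forall>n k :: nat. \<not> p dvd n \<longrightarrow>
     [c_coeff 9 1 (8 * p ^ (2 * k + 1) * n + (6 * p ^ (2 * k + 2) + 4) div 5) = 0] (mod 2) \<and>
     [c_coeff 9 1 (8 * p ^ (2 * k + 1) * n + (26 * p ^ (2 * k + 2) + 4) div 5) = 0] (mod 2)"
proof (intro allI impI conjI)
  fix n k :: nat
  assume n: "\<not> p dvd n"
  have "p mod 20 = 11 \<or> p mod 20 = 19"
    using assms(2) by (simp add: cong_def)
  moreover have "p mod 20 mod 4 = p mod 4" "p mod 20 mod 5 = p mod 5" "p mod 20 \<le> p"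
    by (simp_all add: mod_mod_cancel)
  ultimately have p: "[p = 3] (mod 4)" "p mod 5 = 1 \<or> p mod 5 = 4" "p \<ge> 11"
    by (auto simp: cong_def)
  \<comment> \<open>Squaring gains a factor 2 in the modulus: p^2 is 1 modulo 40. This is what puts
    the arguments into the classes 2 and 6 modulo 8.\<close>
  have "p = 20 * (p div 20) + 11 \<or> p = 20 * (p div 20) + 19"
    using \<open>p mod 20 = 11 \<or> p mod 20 = 19\<close> by (metis mult_div_mod_eq)
  then obtain t where "p = 20 * t + 11 \<or> p = 20 * t + 19"
    by blast
  then have "p\<^sup>2 = 1 + 40 * (10 * t\<^sup>2 + 11 * t + 3) \<or> p\<^sup>2 = 1 + 40 * (10 * t\<^sup>2 + 19 * t + 9)"
    by (elim disjE) (simp_all add: power2_eq_square algebra_simps)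
  then obtain w where w: "p\<^sup>2 = 1 + 40 * w"
    by blast
  have "[p\<^sup>2 = 1] (mod 40)"
    unfolding cong_def w by (rule mod_mult_self2)
  then have "[(p\<^sup>2) ^ (k + 1) = 1 ^ (k + 1)] (mod 40)"
    by (rule cong_pow)
  moreover have "(p\<^sup>2) ^ (k + 1) = p ^ (2 * k + 2)"
    by (simp only: power_mult [symmetric] distrib_left mult_1_right)
  ultimately have "p ^ (2 * k + 2) mod 40 = 1"
    by (simp add: cong_def)
  then obtain j where j: "p ^ (2 * k + 2) = 40 * j + 1"
    by (metis mult_div_mod_eq)
  let ?q = "p ^ (2 * k + 1)"
  have qp: "int ?q * int p = 40 * int j + 1"
    using arg_cong[OF j, of int] by (simp add: mult.commute)
  \<comment> \<open>This is the cofactor of \<open>p ^ (2 * k + 1)\<close> below, with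
    \<open>c\<close> equal to 6 or 26; p is at least 11 and hence prime to 40.\<close>
  have not_dvd: "\<not> int p dvd 40 * int n + c * int p" for c
  proof
    assume "int p dvd 40 * int n + c * int p"
    then have "int p dvd 40 * int n"
      by (simp add: dvd_add_left_iff)
    then have "p dvd 40 * n"
      by (metis int_dvd_int_iff of_nat_mult of_nat_numeral)
    then have "p dvd 40"
      using n assms(1) prime_dvd_mult_iff by blast
    then have "p dvd 2 ^ 3 * 5" by simp
    then have "p dvd 2 \<or> p dvd 5"
      using assms(1) by (metis prime_dvd_mult_iff prime_dvd_power)
    then show False
      using p(3) by (auto dest: dvd_imp_le)
  qed
  obtain b where b: "[b\<^sup>2 = 5] (mod int p)"
    using five_quadratic_residue[OF assms(1)] p by auto
  have "\<not> int p dvd 5"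
    using p(3) zdvd_imp_le[of "int p" 5] by auto

  have eq: "8 * ?q * n + (6 * p ^ (2 * k + 2) + 4) div 5 = 8 * (?q * n + 6 * j) + 2"
    unfolding j by simp
  \<comment> \<open>As \<open>40 * j + 1\<close> is \<open>p ^ (2 * k + 2)\<close>, the power
    \<open>p ^ (2 * k + 1)\<close> splits off and the p-adic valuation is odd.\<close>
  have eq6: "40 * int (?q * n + 6 * j) + 6 = int p ^ (2 * k + 1) * (40 * int n + 6 * int p)"
    using qp by (simp add: algebra_simps)
  show "[c_coeff 9 1 (8 * ?q * n + (6 * p ^ (2 * k + 2) + 4) div 5) = 0] (mod 2)"
    unfolding eq
  proof (rule c_coeff_8n_plus_2_even)
    show "x\<^sup>2 + 5 * y\<^sup>2 \<noteq> 40 * int (?q * n + 6 * j) + 6" for x y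
      unfolding eq6 using quadratic_form_odd_power_not_represented[OF assms(1) p(1) b \<open>\<not> int p dvd 5\<close> not_dvd] by blast
  qed

  have eq': "8 * ?q * n + (26 * p ^ (2 * k + 2) + 4) div 5 = 8 * (?q * n + 26 * j) + 6"
    unfolding j by simp
  have eq26: "40 * int (?q * n + 26 * j) + 26 = int p ^ (2 * k + 1) * (40 * int n + 26 * int p)"
    using qp by (simp add: algebra_simps)
  have "\<not> int p dvd 1"
    using p(3) by auto
  show "[c_coeff 9 1 (8 * ?q * n + (26 * p ^ (2 * k + 2) + 4) div 5) = 0] (mod 2)"
    unfolding eq'
  proof (rule c_coeff_8n_plus_6_even)
    show "x\<^sup>2 + y\<^sup>2 \<noteq> 40 * int (?q * n + 26 * j) + 26" for x y
      unfolding eq26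
      using quadratic_form_odd_power_not_represented[OF assms(1) p(1) _ \<open>\<not> int p dvd 1\<close> not_dvd, of 1 x y k 26] by auto
  qed
qed

end
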